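(* Let $M$ be a matroid. (i) Each MI-orderable antichain $\mathcal{A}$ in $\mathcal{Z}(M)$ satisfies the inequality $$r\Bigl(\bigcap_{X\in\mathcal{A}}X\Bigr)\le \sum_{\emptyset\neq\mathcal{F}\subseteq\mathcal{A}}(-1)^{|\mathcal{F}|+1}\, r\Bigl(\bigcup_{X\in\mathcal{F}}X\Bigr).$$ (ii) If $\mathcal{Z}(M)$ is an MI-lattice, then $M$ and all of its minors are transversal.
   Context: All matroids are finite; $r$ denotes the rank function of $M$. A flat $X$ of $M$ is cyclic if $M|X$ has no isthmuses. The cyclic flats ordered by inclusion form a lattice $\mathcal{Z}(M)$, with $A\lor B=\mathrm{cl}(A\cup B)$ and $A\land B$ the union of the circuits contained in $A\cap B$. An MI-ordering of an antichain $\mathcal{A}$ in a lattice $L$ is a listing $a_1,a_2,\ldots,a_t$ of the elements of $\mathcal{A}$ (each exactly once) such that (i) $a_i\lor a_{i+1}\lor\cdots\lor a_k=a_i\lor a_k$ for all $1\le i<k\le t$, and (ii) $(a_1\land a_2\land\cdots\land a_k)\lor a_{k+1}=a_k\lor a_{k+1}$ for all $1<k<t$. An antichain is MI-orderable if it has an MI-ordering; a lattice is an MI-lattice (MI-orderable) if each of its antichains is MI-orderable. *)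

theory Defs
  imports "HOL-Algebra.Lattice"
begin


section \<open>Matroids\<close>

record 'a matroid =
  ground :: "'a set"
  indep :: "'a set set"

locale matroid =
  fixes M :: "'a matroid"
  assumes finite_ground: "finite (ground M)"
    and indep_subset_ground: "I \<in> indep M \<Longrightarrow> I \<subseteq> ground M"
    and indep_empty: "{} \<in> indep M"
    and indep_subset: "I \<in> indep M \<Longrightarrow> J \<subseteq> I \<Longrightarrow> J \<in> indep M"
    and indep_augment:
      "I \<in> indep M \<Longrightarrow> J \<in> indep M \<Longrightarrow> card I < card J \<Longrightarrow> \<exists>e\<in>J - I. insert e I \<in> indep M"

definition rank :: "'a matroid \<Rightarrow> 'a set \<Rightarrow> nat" where
  "rank M X = Max (card ` {I \<in> indep M. I \<subseteq> X})"

definition closure :: "'a matroid \<Rightarrow> 'a set \<Rightarrow> 'a set" where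
  "closure M X = {e \<in> ground M. rank M (insert e X) = rank M X}"

definition flat :: "'a matroid \<Rightarrow> 'a set \<Rightarrow> bool" where
  "flat M X \<longleftrightarrow> X \<subseteq> ground M \<and> closure M X = X"

definition basis :: "'a matroid \<Rightarrow> 'a set \<Rightarrow> bool" where
  "basis M B \<longleftrightarrow> B \<in> indep M \<and> (\<forall>I\<in>indep M. B \<subseteq> I \<longrightarrow> I = B)"

definition circuit :: "'a matroid \<Rightarrow> 'a set \<Rightarrow> bool" where
  "circuit M C \<longleftrightarrow> C \<subseteq> ground M \<and> C \<notin> indep M \<and> (\<forall>D. D \<subset> C \<longrightarrow> D \<in> indep M)"

definition isthmus :: "'a matroid \<Rightarrow> 'a \<Rightarrow> bool" where
  "isthmus M e \<longleftrightarrow> e \<in> ground M \<and> (\<forall>B. basis M B \<longrightarrow> e \<in> B)"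

definition restriction :: "'a matroid \<Rightarrow> 'a set \<Rightarrow> 'a matroid" where
  "restriction M X = \<lparr>ground = ground M \<inter> X, indep = {I \<in> indep M. I \<subseteq> X}\<rparr>"

definition deletion :: "'a matroid \<Rightarrow> 'a set \<Rightarrow> 'a matroid" where
  "deletion M X = restriction M (ground M - X)"

definition contraction :: "'a matroid \<Rightarrow> 'a set \<Rightarrow> 'a matroid" where
  "contraction M Y = \<lparr>ground = ground M - Y,
     indep = {I. I \<subseteq> ground M - Y \<and> (\<exists>B. basis (restriction M Y) B \<and> I \<union> B \<in> indep M)}\<rparr>"

definition minor :: "'a matroid \<Rightarrow> 'a matroid \<Rightarrow> bool" where
  "minor N M \<longleftrightarrow> (\<exists>X Y. X \<subseteq> ground M \<and> Y \<subseteq> ground M \<and> X \<inter> Y = {} \<and>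
     N = contraction (deletion M X) Y)"

text \<open>The members of the presentation are indexed, so that a set may occur repeatedly.\<close>

definition transversal :: "'a matroid \<Rightarrow> bool" where
  "transversal M \<longleftrightarrow> (\<exists>(n::nat) (S :: nat \<Rightarrow> 'a set). (\<forall>j<n. S j \<subseteq> ground M) \<and>
     (\<forall>I. I \<in> indep M \<longleftrightarrow> (\<exists>\<phi>. inj_on \<phi> I \<and> (\<forall>x\<in>I. \<phi> x < n \<and> x \<in> S (\<phi> x)))))"

section \<open>Cyclic flats\<close>

definition cyclic_flat :: "'a matroid \<Rightarrow> 'a set \<Rightarrow> bool" where
  "cyclic_flat M X \<longleftrightarrow> flat M X \<and> (\<forall>e. \<not> isthmus (restriction M X) e)"

definition cyclic_flat_lattice :: "'a matroid \<Rightarrow> 'a set gorder" where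
  "cyclic_flat_lattice M = \<lparr>carrier = {X. cyclic_flat M X}, eq = (=), le = (\<subseteq>)\<rparr>"

section \<open>MI-orderings\<close>

definition antichain :: "'a gorder \<Rightarrow> 'a set \<Rightarrow> bool" where
  "antichain L A \<longleftrightarrow> A \<subseteq> carrier L \<and> (\<forall>x\<in>A. \<forall>y\<in>A. x \<sqsubseteq>\<^bsub>L\<^esub> y \<longrightarrow> x = y)"

definition MI_ordering :: "'a gorder \<Rightarrow> 'a set \<Rightarrow> nat \<Rightarrow> (nat \<Rightarrow> 'a) \<Rightarrow> bool" where
  "MI_ordering L A t a \<longleftrightarrow> bij_betw a {1..t} A \<and>
     (\<forall>i k. 1 \<le> i \<and> i < k \<and> k \<le> t \<longrightarrow> \<Squnion>\<^bsub>L\<^esub>(a ` {i..k}) = a i \<squnion>\<^bsub>L\<^esub> a k) \<and>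
     (\<forall>k. 1 < k \<and> k < t \<longrightarrow> \<Sqinter>\<^bsub>L\<^esub>(a ` {1..k}) \<squnion>\<^bsub>L\<^esub> a (k + 1) = a k \<squnion>\<^bsub>L\<^esub> a (k + 1))"

definition MI_orderable :: "'a gorder \<Rightarrow> 'a set \<Rightarrow> bool" where
  "MI_orderable L A \<longleftrightarrow> (\<exists>t a. MI_ordering L A t a)"

definition MI_lattice :: "'a gorder \<Rightarrow> bool" where
  "MI_lattice L \<longleftrightarrow> lattice L \<and> (\<forall>A. antichain L A \<longrightarrow> MI_orderable L A)"

section \<open>The lattice operations on cyclic flats\<close>

context matroid
begin

lemma finite_indep: "I \<in> indep M \<Longrightarrow> finite I"
  using finite_ground indep_subset_ground finite_subset by blast

lemma finite_indep_sets: "finite {I \<in> indep M. I \<subseteq> X}"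
  by (rule finite_subset[of _ "Pow (ground M)"]) (use indep_subset_ground finite_ground in auto)

lemma card_le_rank: "I \<in> indep M \<Longrightarrow> I \<subseteq> X \<Longrightarrow> card I \<le> rank M X"
  unfolding rank_def using finite_indep_sets[of X] by (intro Max_ge) auto

lemma rank_attained: "\<exists>I\<in>indep M. I \<subseteq> X \<and> card I = rank M X"
proof -
  have "rank M X \<in> card ` {I \<in> indep M. I \<subseteq> X}"
    unfolding rank_def using finite_indep_sets[of X] indep_empty by (intro Max_in) auto
  then show ?thesis by auto
qed

lemma rank_mono: "X \<subseteq> Y \<Longrightarrow> rank M X \<le> rank M Y"
  by (metis card_le_rank rank_attained subset_trans)

lemma basis_restriction_iff:
  "basis (restriction M X) B \<longleftrightarrow> B \<in> indep M \<and> B \<subseteq> X \<and> card B = rank M X"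
proof
  assume b: "basis (restriction M X) B"
  then have B: "B \<in> indep M" "B \<subseteq> X" by (auto simp: basis_def restriction_def)
  have "card B = rank M X"
  proof (rule ccontr)
    assume "card B \<noteq> rank M X"
    then have "card B < rank M X" using card_le_rank[OF B] by simp
    then obtain J where J: "J \<in> indep M" "J \<subseteq> X" "card B < card J"
      using rank_attained[of X] by auto
    then obtain e where "e \<in> J - B" "insert e B \<in> indep M" using indep_augment[OF B(1)] by blast
    then show False using b B J by (auto simp: basis_def restriction_def)
  qed
  then show "B \<in> indep M \<and> B \<subseteq> X \<and> card B = rank M X" using B by simp
next
  assume B: "B \<in> indep M \<and> B \<subseteq> X \<and> card B = rank M X"
  have "I = B" if "I \<in> indep M" "I \<subseteq> X" "B \<subseteq> I" for I
    using B that card_le_rank[of I X] finite_indep card_seteq[of I B] by auto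
  then show "basis (restriction M X) B" using B by (auto simp: basis_def restriction_def)
qed

lemma extend_to_basis:
  assumes "I \<in> indep M" "I \<subseteq> X"
  obtains B where "basis (restriction M X) B" "I \<subseteq> B"
proof -
  let ?S = "{J \<in> indep M. J \<subseteq> X \<and> I \<subseteq> J}"
  have "finite ?S" by (rule finite_subset[OF _ finite_indep_sets[of X]]) auto
  moreover have "?S \<noteq> {}" using assms by blast
  ultimately obtain B where "B \<in> ?S" "\<forall>J\<in>?S. B \<subseteq> J \<longrightarrow> B = J"
    using finite_has_maximal[of ?S] by blast
  then have "basis (restriction M X) B" "I \<subseteq> B"
    unfolding basis_def restriction_def by simp_all (metis order_trans)
  then show ?thesis by (rule that)
qed

lemma closure_iff_basis:
  assumes "basis (restriction M X) B"
  shows "e \<in> closure M X \<longleftrightarrow> e \<in> ground M \<and> (e \<in> B \<or> insert e B \<notin> indep M)"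
proof -
  have B: "B \<in> indep M" "B \<subseteq> X" "card B = rank M X" using assms basis_restriction_iff by auto
  have 1: "insert e B \<notin> indep M" if "e \<in> closure M X" "e \<notin> B"
    using that card_le_rank[of "insert e B" "insert e X"] B finite_indep[OF B(1)]
    by (auto simp: closure_def)
  have 2: "rank M (insert e X) = rank M X" if "e \<in> B \<or> insert e B \<notin> indep M"
  proof (rule ccontr)
    assume "rank M (insert e X) \<noteq> rank M X"
    then have lt: "rank M X < rank M (insert e X)"
      using rank_mono[OF subset_insertI[of X e]] by linarith
    obtain B' where B': "basis (restriction M (insert e X)) B'" "B \<subseteq> B'"
      using extend_to_basis[OF B(1), of "insert e X"] B by blast
    then have b: "B' \<in> indep M" "B' \<subseteq> insert e X" "card B' = rank M (insert e X)"
      using basis_restriction_iff by auto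
    have "e \<in> B'" using b lt card_le_rank[of B' X] by force
    moreover have "e \<notin> B"
    proof
      assume "e \<in> B"
      then have "insert e X = X" using B by auto
      then show False using lt by simp
    qed
    ultimately show False using that B' b indep_subset[of B' "insert e B"] by auto
  qed
  show ?thesis using 1 2 by (auto simp: closure_def)
qed

lemma basis_of_closure:
  assumes "X \<subseteq> ground M" "basis (restriction M X) B"
  shows "basis (restriction M (closure M X)) B"
proof -
  have B: "B \<in> indep M" "B \<subseteq> X" using assms basis_restriction_iff by auto
  have "B \<subseteq> closure M X" using B assms closure_iff_basis[OF assms(2)] by auto
  moreover have "J = B" if J: "J \<in> indep M" "J \<subseteq> closure M X" "B \<subseteq> J" for J
  proof (rule ccontr)
    assume "J \<noteq> B"
    then obtain e where "e \<in> J" "e \<notin> B" using J by auto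
    then have "insert e B \<in> indep M" using J indep_subset[of J "insert e B"] by auto
    then show False using closure_iff_basis[OF assms(2), of e] \<open>e \<in> J\<close> \<open>e \<notin> B\<close> J by auto
  qed
  ultimately show ?thesis using B by (auto simp: basis_def restriction_def)
qed

lemma subset_closure: "X \<subseteq> ground M \<Longrightarrow> X \<subseteq> closure M X"
  by (auto simp: closure_def insert_absorb)

lemma closure_subset_ground: "closure M X \<subseteq> ground M"
  by (auto simp: closure_def)

lemma closure_mono:
  assumes "X \<subseteq> Y" shows "closure M X \<subseteq> closure M Y"
proof
  fix e assume e: "e \<in> closure M X"
  obtain B where B: "basis (restriction M X) B" using extend_to_basis[OF indep_empty, of X] by blast
  then have b: "B \<in> indep M" "B \<subseteq> Y" using assms basis_restriction_iff by auto
  obtain B' where B': "basis (restriction M Y) B'" "B \<subseteq> B'" using extend_to_basis[OF b] by blast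
  show "e \<in> closure M Y"
    using e B' closure_iff_basis[OF B, of e] closure_iff_basis[OF B'(1), of e]
      indep_subset[of "insert e B'" "insert e B"] by blast
qed

lemma flat_closure:
  assumes "X \<subseteq> ground M" shows "flat M (closure M X)"
proof -
  obtain B where B: "basis (restriction M X) B" using extend_to_basis[OF indep_empty, of X] by blast
  have "closure M (closure M X) = closure M X"
    using closure_iff_basis[OF B] closure_iff_basis[OF basis_of_closure[OF assms B]] by blast
  then show ?thesis using closure_subset_ground by (simp add: flat_def)
qed

lemma closure_subset_flat: "flat M F \<Longrightarrow> X \<subseteq> F \<Longrightarrow> closure M X \<subseteq> F"
  using closure_mono[of X F] by (simp add: flat_def)

lemma dependent_has_circuit:
  assumes "X \<subseteq> ground M" "X \<notin> indep M"
  obtains C where "circuit M C" "C \<subseteq> X"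
proof -
  let ?S = "{D. D \<subseteq> X \<and> D \<notin> indep M}"
  have "finite X" using assms finite_ground finite_subset by blast
  then have "finite ?S" by simp
  moreover have "?S \<noteq> {}" using assms by blast
  ultimately obtain C where C: "C \<in> ?S" "\<forall>D\<in>?S. D \<subseteq> C \<longrightarrow> C = D"
    using finite_has_minimal[of ?S] by blast
  have "D \<in> indep M" if "D \<subset> C" for D
  proof (rule ccontr)
    assume "D \<notin> indep M"
    then have "D \<in> ?S" using that C(1) by auto
    then show False using that C(2) by blast
  qed
  then have "circuit M C" unfolding circuit_def using assms C(1) by auto
  then show ?thesis using C(1) that by blast
qed

lemma circuit_through:
  assumes "e \<in> ground M" "B \<in> indep M" "insert e B \<notin> indep M"
  obtains C where "circuit M C" "C \<subseteq> insert e B" "e \<in> C"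
proof -
  obtain C where C: "circuit M C" "C \<subseteq> insert e B"
    using dependent_has_circuit[of "insert e B"] assms indep_subset_ground by blast
  have "e \<in> C" using C indep_subset[OF assms(2), of C] by (auto simp: circuit_def)
  then show ?thesis using C that by blast
qed

lemma isthmus_iff:
  assumes "X \<subseteq> ground M"
  shows "isthmus (restriction M X) e \<longleftrightarrow> e \<in> X \<and> (\<forall>C. circuit M C \<longrightarrow> C \<subseteq> X \<longrightarrow> e \<notin> C)"
proof (intro iffI conjI allI impI notI)
  assume i: "isthmus (restriction M X) e"
  then show "e \<in> X" by (auto simp: isthmus_def restriction_def)
  fix C assume C: "circuit M C" "C \<subseteq> X" "e \<in> C"
  have "C - {e} \<in> indep M" "C - {e} \<subseteq> X" using C by (auto simp: circuit_def)
  then obtain B where B: "basis (restriction M X) B" "C - {e} \<subseteq> B"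
    using extend_to_basis by blast
  have "B \<in> indep M" using B basis_restriction_iff by blast
  moreover have "e \<in> B" using i B by (auto simp: isthmus_def)
  ultimately have "C \<in> indep M" using B indep_subset[of B C] by auto
  then show False using C by (simp add: circuit_def)
next
  assume e: "e \<in> X \<and> (\<forall>C. circuit M C \<longrightarrow> C \<subseteq> X \<longrightarrow> e \<notin> C)"
  have "e \<in> B" if b: "basis (restriction M X) B" for B
  proof (rule ccontr)
    assume "e \<notin> B"
    have B: "B \<in> indep M" "B \<subseteq> X" using b basis_restriction_iff by auto
    have "insert e B \<notin> indep M"
      using b e \<open>e \<notin> B\<close> B by (auto simp: basis_def restriction_def)
    then obtain C where "circuit M C" "C \<subseteq> insert e B" "e \<in> C"
      using circuit_through[of e B] e assms B by blast
    then show False using e B by blast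
  qed
  then show "isthmus (restriction M X) e"
    using e assms by (auto simp: isthmus_def restriction_def)
qed

lemma cyclic_flat_iff:
  "cyclic_flat M X \<longleftrightarrow> flat M X \<and> (\<forall>e\<in>X. \<exists>C. circuit M C \<and> C \<subseteq> X \<and> e \<in> C)"
proof (cases "flat M X")
  case True
  then have "X \<subseteq> ground M" by (simp add: flat_def)
  then show ?thesis using True isthmus_iff[of X] unfolding cyclic_flat_def by blast
qed (simp add: cyclic_flat_def)

lemma closure_circuit:
  assumes "e \<in> closure M X" "e \<notin> X"
  obtains C where "circuit M C" "C \<subseteq> insert e X" "e \<in> C"
proof -
  obtain B where B: "basis (restriction M X) B" using extend_to_basis[OF indep_empty, of X] by blast
  then have b: "B \<in> indep M" "B \<subseteq> X" using basis_restriction_iff by auto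
  have e: "e \<in> ground M" "insert e B \<notin> indep M"
    using closure_iff_basis[OF B, of e] assms b by auto
  obtain C where C: "circuit M C" "C \<subseteq> insert e B" "e \<in> C"
    by (rule circuit_through[OF e(1) b(1) e(2)])
  have "C \<subseteq> insert e X" using C(2) b(2) by blast
  then show ?thesis using C(1,3) that by blast
qed

lemma cyclic_flat_join:
  assumes "cyclic_flat M A" "cyclic_flat M B"
  shows "cyclic_flat M (closure M (A \<union> B))"
proof -
  have AB: "A \<union> B \<subseteq> ground M" using assms by (auto simp: cyclic_flat_def flat_def)
  have sub: "A \<union> B \<subseteq> closure M (A \<union> B)" using subset_closure[OF AB] .
  have "\<exists>C. circuit M C \<and> C \<subseteq> closure M (A \<union> B) \<and> e \<in> C" if e: "e \<in> closure M (A \<union> B)" for e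
  proof (cases "e \<in> A \<union> B")
    case True
    then show ?thesis using assms sub unfolding cyclic_flat_iff by blast
  next
    case False
    then show ?thesis using closure_circuit[OF e] sub e by (metis insert_subset subset_trans)
  qed
  then show ?thesis using flat_closure[OF AB] unfolding cyclic_flat_iff by blast
qed

lemma cyclic_flat_meet:
  assumes "cyclic_flat M A" "cyclic_flat M B"
  shows "cyclic_flat M (\<Union>{C. circuit M C \<and> C \<subseteq> A \<inter> B})" (is "cyclic_flat M ?U")
proof -
  have fl: "flat M A" "flat M B" using assms by (auto simp: cyclic_flat_def)
  have U: "?U \<subseteq> A \<inter> B" by blast
  have Ug: "?U \<subseteq> ground M" using U fl by (auto simp: flat_def)
  have cl: "closure M ?U \<subseteq> A \<inter> B"
    using closure_subset_flat[OF fl(1), of ?U] closure_subset_flat[OF fl(2), of ?U] U by blast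
  have "closure M ?U \<subseteq> ?U"
  proof (rule subsetI, rule ccontr)
    fix e assume e: "e \<in> closure M ?U" "e \<notin> ?U"
    obtain C where C: "circuit M C" "C \<subseteq> insert e ?U" "e \<in> C"
      using closure_circuit[OF e] by blast
    have "C \<subseteq> A \<inter> B" using C(2) e(1) cl U by blast
    then show False using C e by blast
  qed
  then have "flat M ?U" using subset_closure[OF Ug] Ug by (simp add: flat_def)
  moreover have "\<exists>C. circuit M C \<and> C \<subseteq> ?U \<and> e \<in> C" if "e \<in> ?U" for e
    using that by blast
  ultimately show ?thesis unfolding cyclic_flat_iff by blast
qed

lemma cyclic_flat_least:
  assumes "cyclic_flat M A" "cyclic_flat M B"
  shows "least (cyclic_flat_lattice M) (closure M (A \<union> B)) (Upper (cyclic_flat_lattice M) {A, B})"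
proof -
  let ?J = "closure M (A \<union> B)"
  have "A \<union> B \<subseteq> ?J"
    using assms by (intro subset_closure) (auto simp: cyclic_flat_def flat_def)
  then have "A \<subseteq> ?J" "B \<subseteq> ?J" by blast+
  moreover have "?J \<subseteq> F" if "cyclic_flat M F" "A \<subseteq> F" "B \<subseteq> F" for F
    using that by (intro closure_subset_flat) (auto simp: cyclic_flat_def)
  ultimately show ?thesis
    using cyclic_flat_join[OF assms] assms
    unfolding least_def Upper_def cyclic_flat_lattice_def by simp
qed

lemma cyclic_flat_greatest:
  assumes "cyclic_flat M A" "cyclic_flat M B"
  shows "greatest (cyclic_flat_lattice M) (\<Union>{C. circuit M C \<and> C \<subseteq> A \<inter> B})
    (Lower (cyclic_flat_lattice M) {A, B})"
proof -
  let ?U = "\<Union>{C. circuit M C \<and> C \<subseteq> A \<inter> B}"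
  have "F \<subseteq> ?U" if F: "cyclic_flat M F" "F \<subseteq> A" "F \<subseteq> B" for F
  proof
    fix e assume "e \<in> F"
    then obtain C where "circuit M C" "C \<subseteq> F" "e \<in> C"
      using F(1) unfolding cyclic_flat_iff by blast
    then show "e \<in> ?U" using F by blast
  qed
  moreover have "?U \<subseteq> A" "?U \<subseteq> B" by blast+
  ultimately show ?thesis
    using cyclic_flat_meet[OF assms] assms
    unfolding greatest_def Lower_def cyclic_flat_lattice_def by simp
qed

lemma cyclic_flat_lattice: "lattice (cyclic_flat_lattice M)"
proof
  fix x y assume "x \<in> carrier (cyclic_flat_lattice M)" "y \<in> carrier (cyclic_flat_lattice M)"
  then have "cyclic_flat M x" "cyclic_flat M y" by (auto simp: cyclic_flat_lattice_def)
  then show "\<exists>s. least (cyclic_flat_lattice M) s (Upper (cyclic_flat_lattice M) {x, y})"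
    and "\<exists>s. greatest (cyclic_flat_lattice M) s (Lower (cyclic_flat_lattice M) {x, y})"
    using cyclic_flat_least cyclic_flat_greatest by blast+
qed (auto simp: cyclic_flat_lattice_def fun_eq_iff)

lemma join_cyclic_flats:
  assumes "cyclic_flat M A" "cyclic_flat M B"
  shows "A \<squnion>\<^bsub>cyclic_flat_lattice M\<^esub> B = closure M (A \<union> B)"
proof -
  interpret lattice "cyclic_flat_lattice M" by (rule cyclic_flat_lattice)
  show ?thesis unfolding join_def sup_def
    using cyclic_flat_least[OF assms] least_unique by (metis someI)
qed

lemma meet_cyclic_flats:
  assumes "cyclic_flat M A" "cyclic_flat M B"
  shows "A \<sqinter>\<^bsub>cyclic_flat_lattice M\<^esub> B = \<Union>{C. circuit M C \<and> C \<subseteq> A \<inter> B}"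
proof -
  interpret lattice "cyclic_flat_lattice M" by (rule cyclic_flat_lattice)
  show ?thesis unfolding meet_def inf_def
    using cyclic_flat_greatest[OF assms] greatest_unique by (metis someI)
qed

end

end

theory Submission
  imports Defs
begin

text \<open>For a set \<open>Y\<close> let \<open>\<rho>(X) = r(X \<union> Y)\<close>. In an MI-ordering \<open>a\<^sub>1, \<dots>, a\<^sub>t\<close>, condition (i) makes
  the alternating sum telescope to \<open>\<Sum>\<^sub>i \<rho>(a\<^sub>i) - \<Sum>\<^sub>i \<rho>(a\<^sub>i \<union> a\<^sub>i\<^sub>+\<^sub>1)\<close>, and condition (ii) together with
  submodularity bounds \<open>\<rho>(a\<^sub>1 \<inter> \<dots> \<inter> a\<^sub>t)\<close> by this number, by induction on the length. For part (ii)
  of the theorem, let \<open>\<beta>\<close> be the function on the cyclic flats of \<open>M\<close> with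
  \<open>\<Sum>\<^bsub>G \<supseteq> F\<^esub> \<beta>(G) = \<rho>(E) - \<rho>(F)\<close>. By inclusion-exclusion the inequality says that the sum of \<open>\<beta>\<close>
  over an upset is at most \<open>\<rho>(E) - \<rho>(J)\<close> for every \<open>J\<close> contained in all of its members. Hence
  \<open>\<beta> \<ge> 0\<close>, and by Hall's theorem the complements of the \<open>G\<close>, each taken \<open>\<beta>(G)\<close> times, restricted to
  \<open>E - X - Y\<close>, present the minor of \<open>M\<close> obtained by deleting \<open>X\<close> and contracting \<open>Y\<close>. Since the
  cyclic flats of \<open>M\<close> serve for all minors, those of the minors play no role.\<close>

section \<open>Hall's theorem\<close>

text \<open>Induction after Halmos and Vaughan: either some nonempty proper subset has exactly as
  many neighbours as elements, and the problem splits into that subset and the rest, or every such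
  subset has a surplus, and one element can be matched freely.\<close>

theorem Hall_marriage:
  assumes "finite I" "\<And>x. x \<in> I \<Longrightarrow> finite (N x)" "\<And>J. J \<subseteq> I \<Longrightarrow> card J \<le> card (\<Union>(N ` J))"
  shows "\<exists>\<phi>. inj_on \<phi> I \<and> (\<forall>x\<in>I. \<phi> x \<in> N x)"
  using assms
proof (induction I arbitrary: N rule: finite_psubset_induct)
  case (psubset I)
  have finN: "finite (\<Union>(N ` J))" if "J \<subseteq> I" for J
    using that psubset.hyps psubset.prems(1) by (meson finite_UN finite_subset subsetD)
  consider "I = {}" | J where "J \<subset> I" "J \<noteq> {}" "card (\<Union>(N ` J)) = card J"
    | x where "x \<in> I" "\<And>J. J \<subset> I \<Longrightarrow> J \<noteq> {} \<Longrightarrow> card J < card (\<Union>(N ` J))"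
    using psubset.prems(2) by (metis all_not_in_conv le_neq_implies_less psubsetE)
  then show ?case
  proof cases
    case 1
    then show ?thesis by simp
  next
    case (2 J)
    let ?U = "\<Union>(N ` J)"
    have JI: "J \<subseteq> I" using 2 by blast
    obtain \<phi> where \<phi>: "inj_on \<phi> J" "\<forall>x\<in>J. \<phi> x \<in> N x"
      using psubset.IH[of J N] 2 psubset.prems by (metis JI dual_order.trans subsetD)
    have rest: "I - J \<subset> I" using 2 by blast
    have "card K \<le> card (\<Union>x\<in>K. N x - ?U)" if K: "K \<subseteq> I - J" for K
    proof -
      have fin: "finite J" "finite K" "finite ?U" "finite (\<Union>x\<in>K. N x - ?U)"
        using K JI psubset.hyps finN finN[of K]
        by (auto intro: finite_subset rev_finite_subset[of "\<Union>(N ` K)"])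
      \<comment> \<open>Hall's condition for \<open>J \<union> K\<close>, less the equality for
        \<open>J\<close>, is Hall's condition for \<open>K\<close> once the neighbours of
        \<open>J\<close> are removed.\<close>
      have "card J + card K = card (J \<union> K)"
        using K fin by (subst card_Un_disjoint) auto
      also have "\<dots> \<le> card (\<Union>(N ` (J \<union> K)))"
        using K JI by (intro psubset.prems(2)) blast
      also have "\<Union>(N ` (J \<union> K)) = ?U \<union> (\<Union>x\<in>K. N x - ?U)" by blast
      also have "card \<dots> = card ?U + card (\<Union>x\<in>K. N x - ?U)"
        using fin by (intro card_Un_disjoint) auto
      finally show ?thesis using 2(3) by simp
    qed
    then obtain \<psi> where \<psi>: "inj_on \<psi> (I - J)" "\<forall>x\<in>I - J. \<psi> x \<in> N x - ?U"
      using psubset.IH[of "I - J" "\<lambda>x. N x - ?U", OF rest] psubset.prems(1)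
      by (metis Diff_iff finite_Diff)
    let ?\<chi> = "\<lambda>x. if x \<in> J then \<phi> x else \<psi> x"
    have "\<phi> x \<noteq> \<psi> y" if "x \<in> J" "y \<in> I - J" for x y
      using bspec[OF \<phi>(2) that(1)] bspec[OF \<psi>(2) that(2)] that(1) by auto
    then have "\<phi> x \<noteq> \<psi> y" "\<psi> y \<noteq> \<phi> x" if "x \<in> J" "y \<in> I" "y \<notin> J" for x y using that by fastforce+
    then have "inj_on ?\<chi> I"
      by (intro inj_onI) (auto split: if_splits dest: inj_onD[OF \<phi>(1)] inj_onD[OF \<psi>(1)])
    moreover have "\<forall>x\<in>I. ?\<chi> x \<in> N x" using \<phi> \<psi> by auto
    ultimately show ?thesis by blast
  next
    case (3 x)
    have "card {x} \<le> card (\<Union>(N ` {x}))" using 3 by (intro psubset.prems(2)) simp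
    then obtain y where y: "y \<in> N x" by fastforce
    have "card K \<le> card (\<Union>z\<in>K. N z - {y})" if K: "K \<subseteq> I - {x}" for K
    proof (cases "K = {}")
      case False
      \<comment> \<open>The strict surplus pays for the removal of the single value
        \<open>y\<close>.\<close>
      have "card K < card (\<Union>(N ` K))" using 3 K False by blast
      moreover have "(\<Union>z\<in>K. N z - {y}) = \<Union>(N ` K) - {y}" by blast
      ultimately show ?thesis using card_Diff_singleton_if[of "\<Union>(N ` K)" y] by auto
    qed simp
    then obtain \<psi> where \<psi>: "inj_on \<psi> (I - {x})" "\<forall>z\<in>I - {x}. \<psi> z \<in> N z - {y}"
      using psubset.IH[of "I - {x}" "\<lambda>z. N z - {y}"] 3(1) psubset.prems(1) by auto
    have "inj_on (\<psi>(x := y)) I"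
      using \<psi> unfolding inj_on_def by (metis DiffE DiffI fun_upd_apply insertI1 singletonD)
    moreover have "\<forall>z\<in>I. (\<psi>(x := y)) z \<in> N z" using y \<psi> by auto
    ultimately show ?thesis by blast
  qed
qed

section \<open>Sums over families of sets\<close>

text \<open>Moebius inversion, done by solving a triangular system: a minimal element
  \<open>m\<close> occurs in no upper sum but its own, so its value can be fixed last.\<close>

lemma ex_upper_sums:
  fixes h :: "'b::order \<Rightarrow> int"
  assumes "finite P"
  shows "\<exists>\<beta>. \<forall>F\<in>P. (\<Sum>G | G \<in> P \<and> F \<le> G. \<beta> G) = h F"
  using assms
proof (induction P rule: finite_psubset_induct)
  case (psubset P)
  show ?case
  proof (cases "P = {}")
    case False
    then obtain m where m: "m \<in> P" "\<And>F. F \<in> P \<Longrightarrow> F \<le> m \<Longrightarrow> F = m"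
      using finite_has_minimal[OF psubset.hyps] by metis
    obtain \<beta> where \<beta>: "\<And>F. F \<in> P - {m} \<Longrightarrow> (\<Sum>G | G \<in> P - {m} \<and> F \<le> G. \<beta> G) = h F"
      using psubset.IH[of "P - {m}"] m by blast
    define \<gamma> where "\<gamma> = \<beta>(m := h m - (\<Sum>G | G \<in> P - {m} \<and> m \<le> G. \<beta> G))"
    have "(\<Sum>G | G \<in> P \<and> F \<le> G. \<gamma> G) = h F" if F: "F \<in> P" for F
    proof (cases "F = m")
      case True
      have "{G. G \<in> P \<and> F \<le> G} = insert m {G. G \<in> P - {m} \<and> m \<le> G}" using True m by auto
      then have "(\<Sum>G | G \<in> P \<and> F \<le> G. \<gamma> G) = \<gamma> m + (\<Sum>G | G \<in> P - {m} \<and> m \<le> G. \<gamma> G)"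
        using psubset.hyps by simp
      also have "(\<Sum>G | G \<in> P - {m} \<and> m \<le> G. \<gamma> G) = (\<Sum>G | G \<in> P - {m} \<and> m \<le> G. \<beta> G)"
        by (rule sum.cong) (auto simp: \<gamma>_def)
      finally show ?thesis using True by (simp add: \<gamma>_def)
    next
      case False
      then have "{G. G \<in> P \<and> F \<le> G} = {G. G \<in> P - {m} \<and> F \<le> G}" using F m by auto
      moreover have "(\<Sum>G | G \<in> P - {m} \<and> F \<le> G. \<gamma> G) = (\<Sum>G | G \<in> P - {m} \<and> F \<le> G. \<beta> G)"
        by (rule sum.cong) (auto simp: \<gamma>_def)
      ultimately show ?thesis using \<beta> F False by simp
    qed
    then show ?thesis by blast
  qed simp
qed

lemma sum_Pow_insert:
  fixes g :: "'b set \<Rightarrow> 'c::comm_monoid_add"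
  assumes "finite W" "x \<notin> W"
  shows "sum g (Pow (insert x W)) = sum g (Pow W) + (\<Sum>S\<in>Pow W. g (insert x S))"
proof -
  have "inj_on (insert x) (Pow W)" using assms by (auto simp: inj_on_def)
  then have "(\<Sum>S\<in>Pow W. g (insert x S)) = sum g (insert x ` Pow W)" by (simp add: sum.reindex)
  moreover have "sum g (Pow W \<union> insert x ` Pow W) = sum g (Pow W) + sum g (insert x ` Pow W)"
    using assms by (intro sum.union_disjoint) auto
  ultimately show ?thesis by (simp add: Pow_insert)
qed

text \<open>Among the sets containing \<open>x\<close>, those with and without \<open>y\<close>
  cancel in pairs, except for \<open>{x}\<close> and \<open>{x, y}\<close>. This is one step of the
  telescoping.\<close>

lemma alternating_sum_insert:
  fixes f :: "'b set \<Rightarrow> int"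
  assumes "finite V" "x \<notin> V" "y \<notin> V" "x \<noteq> y"
    and eq: "\<And>S. S \<subseteq> V \<Longrightarrow> S \<noteq> {} \<Longrightarrow> f (insert x (insert y S)) = f (insert x S)"
  shows "(\<Sum>S | S \<subseteq> insert x (insert y V) \<and> S \<noteq> {}. (-1) ^ (card S + 1) * f S) =
    (\<Sum>S | S \<subseteq> insert y V \<and> S \<noteq> {}. (-1) ^ (card S + 1) * f S) + f {x} - f {x, y}"
proof -
  define g where "g S = (-1) ^ (card S + 1) * f S" for S
  have ne: "{S. S \<subseteq> W \<and> S \<noteq> {}} = Pow W - {{}}" for W :: "'b set" by auto
  have red: "sum g {S. S \<subseteq> W \<and> S \<noteq> {}} = sum g (Pow W) - g {}" if "finite W" for W
    unfolding ne using that by (subst sum_diff1) auto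
  have zero: "g (insert x S) + g (insert x (insert y S)) = 0" if S: "S \<in> Pow V - {{}}" for S
  proof -
    have "finite S" "x \<notin> S" "y \<notin> S" using S assms finite_subset by auto
    then show ?thesis using eq[of S] S assms(4) by (simp add: g_def)
  qed
  have "(\<Sum>S\<in>Pow (insert y V). g (insert x S))
      = (\<Sum>S\<in>Pow V. g (insert x S) + g (insert x (insert y S)))"
    using assms by (simp add: sum_Pow_insert sum.distrib)
  also have "\<dots> = (\<Sum>S\<in>{{}}. g (insert x S) + g (insert x (insert y S)))"
    using assms(1) zero by (intro sum.mono_neutral_right) auto
  also have "\<dots> = f {x} - f {x, y}" using assms(4) by (simp add: g_def)
  finally have "(\<Sum>S\<in>Pow (insert y V). g (insert x S)) = f {x} - f {x, y}" .
  then have "sum g (Pow (insert x (insert y V))) = sum g (Pow (insert y V)) + f {x} - f {x, y}"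
    using assms by (subst sum_Pow_insert) auto
  then have "sum g {S. S \<subseteq> insert x (insert y V) \<and> S \<noteq> {}}
      = sum g {S. S \<subseteq> insert y V \<and> S \<noteq> {}} + f {x} - f {x, y}"
    using assms(1) by (simp add: red)
  then show ?thesis unfolding g_def .
qed

section \<open>Rank and cyclic flats\<close>

context matroid
begin

lemma rank_closure:
  assumes "X \<subseteq> ground M"
  shows "rank M (closure M X) = rank M X"
proof -
  obtain B where "basis (restriction M X) B"
    using extend_to_basis[OF indep_empty, of X] by blast
  then show ?thesis using basis_of_closure[OF assms] by (simp add: basis_restriction_iff)
qed

lemma rank_Un_closure_subset:
  assumes "W \<subseteq> ground M" "X \<subseteq> W" "Z \<subseteq> closure M X"
  shows "rank M (W \<union> Z) = rank M W"
proof (rule antisym)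
  have "W \<union> Z \<subseteq> closure M W"
    using assms subset_closure closure_mono[of X W] by blast
  then show "rank M (W \<union> Z) \<le> rank M W"
    using rank_mono[of "W \<union> Z" "closure M W"] rank_closure[OF assms(1)] by simp
qed (simp add: rank_mono)

text \<open>A basis of the intersection extends to a basis \<open>L\<close> of the union. The parts
  of \<open>L\<close> in \<open>A\<close> and in \<open>B\<close> are independent and overlap in at
  least \<open>rank M (A \<inter> B)\<close> elements.\<close>

lemma rank_submodular: "rank M (A \<union> B) + rank M (A \<inter> B) \<le> rank M A + rank M B"
proof -
  obtain K where K: "K \<in> indep M" "K \<subseteq> A \<inter> B" "card K = rank M (A \<inter> B)"
    using rank_attained[of "A \<inter> B"] by blast
  obtain L where L0: "basis (restriction M (A \<union> B)) L" "K \<subseteq> L"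
    using extend_to_basis[OF K(1), of "A \<union> B"] K(2) by blast
  then have L: "L \<in> indep M" "L \<subseteq> A \<union> B" "card L = rank M (A \<union> B)"
    by (auto simp: basis_restriction_iff)
  have fin: "finite L" using L finite_indep by blast
  have "card (L \<inter> A) \<le> rank M A" "card (L \<inter> B) \<le> rank M B"
    using L(1) by (auto intro!: card_le_rank intro: indep_subset)
  moreover have "card (L \<inter> A) + card (L \<inter> B) = card L + card (L \<inter> (A \<inter> B))"
  proof -
    have "L \<inter> A \<union> L \<inter> B = L" "(L \<inter> A) \<inter> (L \<inter> B) = L \<inter> (A \<inter> B)" using L(2) by auto
    then show ?thesis using card_Un_Int[of "L \<inter> A" "L \<inter> B"] fin by simp
  qed
  moreover have "card K \<le> card (L \<inter> (A \<inter> B))"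
    using K L0 fin by (intro card_mono) auto
  ultimately show ?thesis using K L by linarith
qed

section \<open>Closures that are cyclic flats\<close>

lemma finite_cyclic_flats: "finite {X. cyclic_flat M X}"
  by (rule finite_subset[of _ "Pow (ground M)"])
    (use finite_ground in \<open>auto simp: cyclic_flat_def flat_def\<close>)

lemma cyclic_flat_subset_ground: "cyclic_flat M X \<Longrightarrow> X \<subseteq> ground M"
  by (simp add: cyclic_flat_def flat_def)

lemma cyclic_flat_closure:
  assumes "X \<subseteq> ground M" "\<And>e. e \<in> X \<Longrightarrow> \<exists>C. circuit M C \<and> C \<subseteq> X \<and> e \<in> C"
  shows "cyclic_flat M (closure M X)"
proof -
  have sub: "X \<subseteq> closure M X" using subset_closure[OF assms(1)] .
  have "\<exists>C. circuit M C \<and> C \<subseteq> closure M X \<and> e \<in> C" if e: "e \<in> closure M X" for e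
  proof (cases "e \<in> X")
    case True
    then show ?thesis using assms(2) sub by blast
  next
    case False
    then show ?thesis using closure_circuit[OF e] sub e by (metis insert_subset subset_trans)
  qed
  then show ?thesis using flat_closure[OF assms(1)] unfolding cyclic_flat_iff by blast
qed

text \<open>The family may be empty: this yields the least cyclic flat, the closure of the empty
  set.\<close>

lemma cyclic_flat_closure_Union:
  assumes "\<And>X. X \<in> F \<Longrightarrow> cyclic_flat M X"
  shows "cyclic_flat M (closure M (\<Union>F))"
proof (rule cyclic_flat_closure)
  show "\<Union>F \<subseteq> ground M" using assms cyclic_flat_subset_ground by blast
  show "\<exists>C. circuit M C \<and> C \<subseteq> \<Union>F \<and> e \<in> C" if "e \<in> \<Union>F" for e
    using that assms unfolding cyclic_flat_iff by blast
qed

lemma cyclic_flat_circuit_closure: "circuit M C \<Longrightarrow> cyclic_flat M (closure M C)"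
  by (rule cyclic_flat_closure) (auto simp: circuit_def)

section \<open>The inequality for MI-orderable antichains\<close>

text \<open>Both lattice conditions become containments in matroid closures, the form that rank
  arguments can use. The lattice meet lies inside the intersection and may be smaller; enlarging it
  to the intersection keeps the containment.\<close>

lemma MI_ordering_cyclic_flatsD:
  assumes "MI_ordering (cyclic_flat_lattice M) A t a" "\<And>X. X \<in> A \<Longrightarrow> cyclic_flat M X"
  shows MI_ordering_join:
      "\<lbrakk>1 \<le> i; i \<le> j; j \<le> k; i < k; k \<le> t\<rbrakk> \<Longrightarrow> a j \<subseteq> closure M (a i \<union> a k)"
    and MI_ordering_meet:
      "\<lbrakk>1 \<le> k; k < t\<rbrakk> \<Longrightarrow> a k \<subseteq> closure M (\<Inter>(a ` {1..k}) \<union> a (k + 1))"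
proof -
  let ?L = "cyclic_flat_lattice M"
  interpret L: lattice ?L by (rule cyclic_flat_lattice)
  have bij: "bij_betw a {1..t} A"
    and join: "\<And>i k. 1 \<le> i \<Longrightarrow> i < k \<Longrightarrow> k \<le> t \<Longrightarrow> \<Squnion>\<^bsub>?L\<^esub>(a ` {i..k}) = a i \<squnion>\<^bsub>?L\<^esub> a k"
    and meet: "\<And>k. 1 < k \<Longrightarrow> k < t \<Longrightarrow> \<Sqinter>\<^bsub>?L\<^esub>(a ` {1..k}) \<squnion>\<^bsub>?L\<^esub> a (k + 1) = a k \<squnion>\<^bsub>?L\<^esub> a (k + 1)"
    using assms(1) by (auto simp: MI_ordering_def)
  have cyc: "cyclic_flat M (a i)" if "1 \<le> i" "i \<le> t" for i
    using that bij assms(2) by (auto simp: bij_betw_def)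
  have carr: "a ` {i..k} \<subseteq> carrier ?L" if "1 \<le> i" "k \<le> t" for i k
    using that cyc by (auto simp: cyclic_flat_lattice_def)
  show "a j \<subseteq> closure M (a i \<union> a k)" if "1 \<le> i" "i \<le> j" "j \<le> k" "i < k" "k \<le> t"
  proof -
    define s where "s = \<Squnion>\<^bsub>?L\<^esub>(a ` {i..k})"
    have "least ?L s (Upper ?L (a ` {i..k}))"
      unfolding s_def using that carr by (intro L.finite_sup_least) auto
    then have "a j \<sqsubseteq>\<^bsub>?L\<^esub> s"
      by (rule least_Upper_above) (use that carr in auto)
    then have "a j \<subseteq> s" by (simp add: cyclic_flat_lattice_def)
    then show ?thesis unfolding s_def using join[of i k] join_cyclic_flats[of "a i" "a k"] cyc that by simp
  qed
  show "a k \<subseteq> closure M (\<Inter>(a ` {1..k}) \<union> a (k + 1))" if k: "1 \<le> k" "k < t"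
  proof -
    have gr: "\<Inter>(a ` {1..k}) \<union> a (k + 1) \<subseteq> ground M"
      using k cyc[THEN cyclic_flat_subset_ground, of k]
        cyc[THEN cyclic_flat_subset_ground, of "k + 1"] by auto
    show ?thesis
    \<comment> \<open>Condition (ii) begins at \<open>k = 2\<close>; for \<open>k = 1\<close> the
      intersection is \<open>a 1\<close> itself.\<close>
    proof (cases "k = 1")
      case True
      then show ?thesis using subset_closure[OF gr] by simp
    next
      case False
      define m where "m = \<Sqinter>\<^bsub>?L\<^esub>(a ` {1..k})"
      have "greatest ?L m (Lower ?L (a ` {1..k}))"
        unfolding m_def using k carr by (intro L.finite_inf_greatest) auto
      then have "m \<in> carrier ?L" "\<And>i. i \<in> {1..k} \<Longrightarrow> m \<sqsubseteq>\<^bsub>?L\<^esub> a i"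
        using carr[of 1 k] k by (auto simp: greatest_closed intro: greatest_Lower_below)
      then have mc: "cyclic_flat M m" and "m \<subseteq> \<Inter>(a ` {1..k})"
        unfolding cyclic_flat_lattice_def by (simp, intro INT_greatest) simp
      then have "closure M (m \<union> a (k + 1)) \<subseteq> closure M (\<Inter>(a ` {1..k}) \<union> a (k + 1))"
        by (intro closure_mono) blast
      moreover have "closure M (m \<union> a (k + 1)) = closure M (a k \<union> a (k + 1))"
        using meet[of k] join_cyclic_flats[OF mc, of "a (k + 1)"]
          join_cyclic_flats[of "a k" "a (k + 1)"] cyc k False by (simp add: m_def)
      moreover have "a k \<subseteq> closure M (a k \<union> a (k + 1))"
        using subset_closure[of "a k \<union> a (k + 1)"] cyc[THEN cyclic_flat_subset_ground] k by auto
      ultimately show ?thesis by blast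
    qed
  qed
qed

text \<open>The auxiliary set \<open>Y\<close> makes the argument serve contractions by
  \<open>Y\<close>; \<open>Y = {}\<close> is the inequality of part (i).\<close>

lemma MI_ordering_inequality:
  assumes ord: "MI_ordering (cyclic_flat_lattice M) A t a"
    and A: "\<And>X. X \<in> A \<Longrightarrow> cyclic_flat M X" "A \<noteq> {}" and Y: "Y \<subseteq> ground M"
  shows "int (rank M (\<Inter>A \<union> Y)) \<le>
    (\<Sum>F | F \<subseteq> A \<and> F \<noteq> {}. (-1) ^ (card F + 1) * int (rank M (\<Union>F \<union> Y)))"
proof -
  have bij: "bij_betw a {1..t} A" using ord by (simp add: MI_ordering_def)
  have gr: "a i \<subseteq> ground M" if "1 \<le> i" "i \<le> t" for i
    using that bij by (intro cyclic_flat_subset_ground A(1)) (auto simp: bij_betw_def)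
  define f where "f S = int (rank M (\<Union>(a ` S) \<union> Y))" for S
  \<comment> \<open>Summing over sets of positions rather than over subfamilies makes initial
    segments of the ordering available for induction.\<close>
  define T where "T k = (\<Sum>S | S \<subseteq> {1..k} \<and> S \<noteq> {}. (-1) ^ (card S + 1) * f S)" for k
  have T_Suc: "T (Suc k) = T k + f {Suc k} - f {Suc k, k}" if k: "1 \<le> k" "k < t" for k
  proof -
    \<comment> \<open>For any \<open>i\<close> in \<open>S\<close>, condition (i) puts
      \<open>a k\<close> into the closure of \<open>a i \<union> a (Suc k)\<close>, so the index
      \<open>k\<close> adds nothing to the rank.\<close>
    have "f (insert (Suc k) (insert k S)) = f (insert (Suc k) S)"
      if S: "S \<subseteq> {1..<k}" "S \<noteq> {}" for S
    proof -
      obtain i where i: "i \<in> S" using S by blast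
      then have i': "1 \<le> i" "i < k" using S by auto
      have "a k \<subseteq> closure M (a i \<union> a (Suc k))"
        using MI_ordering_join[OF ord A(1), of i k "Suc k"] i' k by simp
      moreover have "\<Union>(a ` insert (Suc k) S) \<union> Y \<subseteq> ground M"
        using S k Y by (auto dest!: subsetD[OF gr, rotated 2])
      ultimately have "rank M (\<Union>(a ` insert (Suc k) S) \<union> Y \<union> a k)
          = rank M (\<Union>(a ` insert (Suc k) S) \<union> Y)"
        using i by (intro rank_Un_closure_subset) auto
      moreover have "\<Union>(a ` insert (Suc k) S) \<union> Y \<union> a k
          = \<Union>(a ` insert (Suc k) (insert k S)) \<union> Y" by auto
      ultimately show ?thesis by (simp add: f_def)
    qed
    moreover have "insert k {1..<k} = {1..k}" "insert (Suc k) {1..k} = {1..Suc k}"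
      using k by auto
    ultimately show ?thesis
      using alternating_sum_insert[of "{1..<k}" "Suc k" k f] by (simp add: T_def)
  qed
  have main: "int (rank M (\<Inter>(a ` {1..k}) \<union> Y)) \<le> T k" if "1 \<le> k" "k \<le> t" for k
    using that
  proof (induction k rule: nat_induct_at_least)
    case base
    have "{S. S \<subseteq> {1..1::nat} \<and> S \<noteq> {}} = {{1}}" by auto
    then show ?case by (simp add: T_def f_def)
  next
    case (Suc k)
    let ?P = "\<Inter>(a ` {1..k})"
    have k: "1 \<le> k" "k < t" using Suc by auto
    have P: "?P \<subseteq> ground M" using gr[of 1] k by force
    have eq: "\<Inter>(a ` {1..Suc k}) = ?P \<inter> a (Suc k)"
      by (simp add: atLeastAtMostSuc_conv Int_commute)
    \<comment> \<open>By condition (ii), \<open>a k\<close> lies in the closure of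
      \<open>?P \<union> a (Suc k)\<close>; hence the subtracted term \<open>f {Suc k, k}\<close> is
      at most the rank of the union in submodularity.\<close>
    have "rank M (a (Suc k) \<union> a k \<union> Y) \<le> rank M (?P \<union> a (Suc k) \<union> Y \<union> a k)"
      by (rule rank_mono) blast
    also have "\<dots> = rank M (?P \<union> a (Suc k) \<union> Y)"
      using MI_ordering_meet[OF ord A(1) k] P gr[of "Suc k"] Y k
      by (intro rank_Un_closure_subset) auto
    finally have "f {Suc k, k} \<le> int (rank M (?P \<union> a (Suc k) \<union> Y))" by (simp add: f_def)
    moreover have "rank M (?P \<union> a (Suc k) \<union> Y) + rank M (?P \<inter> a (Suc k) \<union> Y)
        \<le> rank M (?P \<union> Y) + rank M (a (Suc k) \<union> Y)"
    proof -
      have "(?P \<union> Y) \<union> (a (Suc k) \<union> Y) = ?P \<union> a (Suc k) \<union> Y"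
        "(?P \<union> Y) \<inter> (a (Suc k) \<union> Y) = ?P \<inter> a (Suc k) \<union> Y" by blast+
      then show ?thesis using rank_submodular[of "?P \<union> Y" "a (Suc k) \<union> Y"] by simp
    qed
    moreover have "int (rank M (?P \<union> Y)) \<le> T k" using Suc by simp
    ultimately show ?case unfolding eq T_Suc[OF k] by (simp add: f_def)
  qed
  have inj: "inj_on a {1..t}" and im: "a ` {1..t} = A" using bij by (auto simp: bij_betw_def)
  have "1 \<le> t" using A(2) im by (cases t) auto
  moreover have "T t = (\<Sum>F | F \<subseteq> A \<and> F \<noteq> {}. (-1) ^ (card F + 1) * int (rank M (\<Union>F \<union> Y)))"
    unfolding T_def
  proof (rule sum.reindex_cong[symmetric, where l = "image a"])
    show "inj_on (image a) {S. S \<subseteq> {1..t} \<and> S \<noteq> {}}"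
      using inj by (auto simp: inj_on_def inj_on_image_eq_iff)
    show "{F. F \<subseteq> A \<and> F \<noteq> {}} = image a ` {S. S \<subseteq> {1..t} \<and> S \<noteq> {}}"
      using im by (fastforce simp: subset_image_iff)
    show "(-1) ^ (card (a ` S) + 1) * int (rank M (\<Union>(a ` S) \<union> Y)) = (-1) ^ (card S + 1) * f S"
      if "S \<in> {S. S \<subseteq> {1..t} \<and> S \<noteq> {}}" for S
      using that inj by (simp add: f_def card_image inj_on_subset)
  qed
  ultimately show ?thesis using main[of t] im by simp
qed

section \<open>The Mason--Ingleton condition implies transversality\<close>

text \<open>\<open>U\<close> is the union of the principal upsets of its minimal members, which form
  an antichain. Inclusion-exclusion reduces its sum to sums over intersections of these, which the
  equation for \<open>\<beta>\<close> turns into ranks, and \<open>MI\<close> bounds the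
  result.\<close>

lemma upset_sum_le:
  fixes \<beta> :: "'a set \<Rightarrow> int"
  assumes Y: "Y \<subseteq> ground M"
    and MI: "\<And>A. antichain (cyclic_flat_lattice M) A \<Longrightarrow> A \<noteq> {} \<Longrightarrow> int (rank M (\<Inter>A \<union> Y)) \<le>
      (\<Sum>F | F \<subseteq> A \<and> F \<noteq> {}. (-1) ^ (card F + 1) * int (rank M (\<Union>F \<union> Y)))"
    and \<beta>: "\<And>F. cyclic_flat M F \<Longrightarrow> (\<Sum>G | cyclic_flat M G \<and> F \<subseteq> G. \<beta> G) =
      int (rank M (ground M)) - int (rank M (F \<union> Y))"
    and U: "\<And>G. G \<in> U \<Longrightarrow> cyclic_flat M G \<and> J \<subseteq> G"
      "\<And>G H. G \<in> U \<Longrightarrow> cyclic_flat M H \<Longrightarrow> G \<subseteq> H \<Longrightarrow> H \<in> U"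
    and J: "J \<subseteq> ground M"
  shows "(\<Sum>G\<in>U. \<beta> G) \<le> int (rank M (ground M)) - int (rank M (J \<union> Y))"
proof (cases "U = {}")
  case True
  then show ?thesis using rank_mono[of "J \<union> Y" "ground M"] J Y by simp
next
  case False
  have finU: "finite U" using U(1) by (intro finite_subset[OF _ finite_cyclic_flats]) auto
  define A where "A = {G \<in> U. \<forall>H\<in>U. H \<subseteq> G \<longrightarrow> H = G}"
  have below: "\<exists>X\<in>A. X \<subseteq> G" if G: "G \<in> U" for G
  proof -
    obtain X where "X \<in> U" "X \<subseteq> G" "\<forall>H\<in>U. H \<subseteq> X \<longrightarrow> X = H"
      using finite_has_minimal2[OF finU G] by auto
    then show ?thesis by (auto simp: A_def)
  qed
  have A: "A \<noteq> {}" "A \<subseteq> U" using below False by (blast, simp add: A_def)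
  have finA: "finite A" using A finU finite_subset by blast
  have "antichain (cyclic_flat_lattice M) A"
    using U(1) by (auto simp: antichain_def A_def cyclic_flat_lattice_def)
  note MI = MI[OF this A(1)]
  \<comment> \<open>Cutting down to the finite set of cyclic flats makes \<open>s\<close> additive
    on all disjoint families, as inclusion-exclusion requires; sums over infinite sets are 0 by
    default.\<close>
  define s where "s V = (\<Sum>G\<in>{G. cyclic_flat M G} \<inter> V. \<beta> G)" for V
  have s_add: "s (V \<union> W) = s V + s W" if "disjnt V W" for V W
    unfolding s_def Int_Un_distrib using that finite_cyclic_flats
    by (intro sum.union_disjoint) (auto simp: disjnt_def)
  have s_above: "s (\<Inter>X\<in>F. {G. X \<subseteq> G}) = int (rank M (ground M)) - int (rank M (\<Union>F \<union> Y))"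
    if F: "F \<subseteq> A" "F \<noteq> {}" for F
  proof -
    let ?K = "closure M (\<Union>F)"
    have cyc: "\<And>X. X \<in> F \<Longrightarrow> cyclic_flat M X" using F A U(1) by blast
    then have gr: "\<Union>F \<subseteq> ground M" using cyclic_flat_subset_ground by blast
    \<comment> \<open>A cyclic flat contains every member of \<open>F\<close> iff it contains
      \<open>?K\<close>, so an intersection of principal upsets is again principal.\<close>
    have "{G. cyclic_flat M G} \<inter> (\<Inter>X\<in>F. {G. X \<subseteq> G}) = {G. cyclic_flat M G \<and> ?K \<subseteq> G}"
    proof -
      have "?K \<subseteq> G \<longleftrightarrow> (\<forall>X\<in>F. X \<subseteq> G)" if "cyclic_flat M G" for G
        using subset_closure[OF gr] closure_subset_flat[of G "\<Union>F"] that
        unfolding cyclic_flat_def by (meson Sup_le_iff subset_trans)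
      then show ?thesis by auto
    qed
    then have "s (\<Inter>X\<in>F. {G. X \<subseteq> G}) = int (rank M (ground M)) - int (rank M (?K \<union> Y))"
      unfolding s_def using \<beta>[OF cyclic_flat_closure_Union[OF cyc]] by simp
    moreover have "rank M (\<Union>F \<union> Y \<union> ?K) = rank M (\<Union>F \<union> Y)"
      using gr Y by (intro rank_Un_closure_subset) auto
    moreover have "\<Union>F \<union> Y \<union> ?K = ?K \<union> Y" using subset_closure[OF gr] by blast
    ultimately show ?thesis by simp
  qed
  let ?N = "{F. F \<subseteq> A \<and> F \<noteq> {}}"
  have "U = {G. cyclic_flat M G} \<inter> (\<Union>X\<in>A. {G. X \<subseteq> G})"
  proof (intro equalityI subsetI)
    fix G assume "G \<in> U"
    then show "G \<in> {G. cyclic_flat M G} \<inter> (\<Union>X\<in>A. {G. X \<subseteq> G})" using U(1) below by simp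
  next
    fix G assume "G \<in> {G. cyclic_flat M G} \<inter> (\<Union>X\<in>A. {G. X \<subseteq> G})"
    then show "G \<in> U" using U(2) A(2) by auto
  qed
  then have "(\<Sum>G\<in>U. \<beta> G) = s (\<Union>X\<in>A. {G. X \<subseteq> G})" by (simp add: s_def)
  also have "\<dots> = (\<Sum>F\<in>?N. (-1) ^ (card F + 1) * s (\<Inter>X\<in>F. {G. X \<subseteq> G}))"
    using Incl_Excl_UN[OF s_add finA, where G = "\<lambda>X. {G. X \<subseteq> G}"] by simp
  also have "\<dots> = (\<Sum>F\<in>?N. (-1) ^ (card F + 1) * int (rank M (ground M))
      - (-1) ^ (card F + 1) * int (rank M (\<Union>F \<union> Y)))"
    by (rule sum.cong) (auto simp: s_above algebra_simps)
  also have "\<dots> = (\<Sum>F\<in>?N. (-1) ^ (card F + 1)) * int (rank M (ground M))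
      - (\<Sum>F\<in>?N. (-1) ^ (card F + 1) * int (rank M (\<Union>F \<union> Y)))"
    by (simp only: sum_subtractf sum_distrib_right)
  \<comment> \<open>Inclusion-exclusion for copies of one singleton, whose union over the nonempty
    \<open>A\<close> has one element.\<close>
  also have "(\<Sum>F\<in>?N. (-1) ^ (card F + 1)) = (1::int)"
  proof -
    have "(\<Sum>F\<in>?N. (-1::int) ^ (card F + 1)) = int (card (\<Union>X\<in>A. {()}))"
      by (subst Incl_Excl_UN[of "\<lambda>S. int (card S)" A "\<lambda>X. {()}"])
        (use finA in \<open>auto intro!: sum.cong simp: card_Un_disjnt\<close>)
    then show ?thesis using A by simp
  qed
  also have "1 * int (rank M (ground M)) - (\<Sum>F\<in>?N. (-1) ^ (card F + 1) * int (rank M (\<Union>F \<union> Y)))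
      \<le> int (rank M (ground M)) - int (rank M (\<Inter>A \<union> Y))"
    using MI by simp
  also have "\<dots> \<le> int (rank M (ground M)) - int (rank M (J \<union> Y))"
    using rank_mono[of "J \<union> Y" "\<Inter>A \<union> Y"] U(1) A by auto
  finally show ?thesis .
qed

section \<open>A presentation obtained from Hall's theorem\<close>

lemma basis_spanning:
  assumes "Y \<subseteq> ground M" "basis (restriction M Y) B"
  shows "Y \<subseteq> closure M B"
proof
  fix e assume e: "e \<in> Y"
  have B: "B \<in> indep M" "B \<subseteq> Y" "card B = rank M Y"
    using assms(2) by (auto simp: basis_restriction_iff)
  have "rank M (insert e B) \<le> rank M Y" using B e by (intro rank_mono) auto
  also have "\<dots> \<le> rank M B" using B card_le_rank[of B B] by simp
  finally have "rank M (insert e B) = rank M B"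
    using rank_mono[OF subset_insertI] by (rule antisym)
  then show "e \<in> closure M B" using assms(1) e by (auto simp: closure_def)
qed

lemma rank_less_card:
  assumes "X \<subseteq> ground M" "X \<notin> indep M"
  shows "rank M X < card X"
proof -
  obtain I where "I \<in> indep M" "I \<subseteq> X" "card I = rank M X" using rank_attained by blast
  moreover have "finite X" using assms(1) finite_ground finite_subset by blast
  ultimately show ?thesis using assms(2) by (metis psubsetI psubset_card_mono)
qed

text \<open>The independence condition is that of the contraction by \<open>Y\<close> cut down to
  \<open>W\<close>. The count \<open>meeting\<close> serves both directions: it gives Hall's
  condition for independent sets and too few members for dependent ones.\<close>

theorem Mason_Ingleton:
  assumes Y: "Y \<subseteq> ground M"
    and MI: "\<And>A. antichain (cyclic_flat_lattice M) A \<Longrightarrow> A \<noteq> {} \<Longrightarrow> int (rank M (\<Inter>A \<union> Y)) \<le>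
      (\<Sum>F | F \<subseteq> A \<and> F \<noteq> {}. (-1) ^ (card F + 1) * int (rank M (\<Union>F \<union> Y)))"
    and W: "W \<subseteq> ground M - Y"
  shows "\<exists>(n::nat) S. (\<forall>j<n. S j \<subseteq> W) \<and>
    (\<forall>I. I \<subseteq> W \<and> (\<exists>B. basis (restriction M Y) B \<and> I \<union> B \<in> indep M) \<longleftrightarrow>
      (\<exists>\<phi>. inj_on \<phi> I \<and> (\<forall>x\<in>I. \<phi> x < n \<and> x \<in> S (\<phi> x))))"
proof -
  let ?P = "{G. cyclic_flat M G}" and ?R = "int (rank M (ground M))"
  obtain \<beta> where "\<forall>F\<in>?P. (\<Sum>G | G \<in> ?P \<and> F \<subseteq> G. \<beta> G) = ?R - int (rank M (F \<union> Y))"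
    using ex_upper_sums[OF finite_cyclic_flats, of "\<lambda>F. ?R - int (rank M (F \<union> Y))"] by blast
  then have \<beta>: "(\<Sum>G | cyclic_flat M G \<and> F \<subseteq> G. \<beta> G) = ?R - int (rank M (F \<union> Y))"
    if "cyclic_flat M F" for F using that by simp
  note upset = upset_sum_le[OF Y MI \<beta>]
  have fin: "finite {G. cyclic_flat M G \<and> Q G}" for Q
    by (rule finite_subset[OF _ finite_cyclic_flats]) auto
  \<comment> \<open>The cyclic flats strictly above \<open>F\<close> form an upset whose members
    contain \<open>F\<close>, so \<open>upset\<close> bounds their sum by the sum over all those
    containing \<open>F\<close>; the difference is \<open>\<beta> F\<close>.\<close>
  have nonneg: "0 \<le> \<beta> F" if F: "cyclic_flat M F" for F
  proof -
    have "{G. cyclic_flat M G \<and> F \<subseteq> G} = insert F {G. cyclic_flat M G \<and> F \<subset> G}"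
      using F by auto
    then have "\<beta> F + (\<Sum>G | cyclic_flat M G \<and> F \<subset> G. \<beta> G) = ?R - int (rank M (F \<union> Y))"
      using \<beta>[OF F] fin by simp
    moreover have "(\<Sum>G | cyclic_flat M G \<and> F \<subset> G. \<beta> G) \<le> ?R - int (rank M (F \<union> Y))"
      using cyclic_flat_subset_ground[OF F] by (intro upset) auto
    ultimately show ?thesis by simp
  qed
  \<comment> \<open>The closure of the empty set lies in every cyclic flat and adds no rank to
    \<open>Y\<close>, so its upper sum is the whole sum.\<close>
  have total: "(\<Sum>G\<in>?P. \<beta> G) = ?R - int (rank M Y)"
  proof -
    have "cyclic_flat M (closure M {})" using cyclic_flat_closure_Union[of "{}"] by simp
    moreover have "rank M (Y \<union> closure M {}) = rank M Y"
      using Y by (intro rank_Un_closure_subset[of _ "{}"]) auto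
    moreover have "{G. cyclic_flat M G \<and> closure M {} \<subseteq> G} = ?P"
      using closure_subset_flat by (auto simp: cyclic_flat_def)
    ultimately show ?thesis using \<beta>[of "closure M {}"] by (simp add: Un_commute)
  qed
  \<comment> \<open>Labelled copies realise the multiplicities; \<open>nat\<close> loses nothing,
    since \<open>\<beta>\<close> is nonnegative on cyclic flats.\<close>
  define D where "D = Sigma ?P (\<lambda>G. {..<nat (\<beta> G)})"
  have finD: "finite D" using finite_cyclic_flats by (simp add: D_def)
  have count: "int (card {p \<in> D. Q (fst p)}) = (\<Sum>G | cyclic_flat M G \<and> Q G. \<beta> G)" for Q
  proof -
    have "{p \<in> D. Q (fst p)} = Sigma {G. cyclic_flat M G \<and> Q G} (\<lambda>G. {..<nat (\<beta> G)})"
      by (auto simp: D_def)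
    then show ?thesis using fin nonneg by simp
  qed
  define n where "n = card D"
  obtain h where h: "bij_betw h {..<n} D"
    using ex_bij_betw_nat_finite[OF finD] by (auto simp: n_def atLeast0LessThan)
  define S where "S j = W - fst (h j)" for j
  \<comment> \<open>For \<open>C \<subseteq> W\<close>, the member \<open>S j\<close> meets
    \<open>C\<close> iff the flat \<open>fst (h j)\<close> does not contain \<open>C\<close>, so
    this counts the members meeting \<open>C\<close>.\<close>
  have meeting: "int (card {j. j < n \<and> \<not> C \<subseteq> fst (h j)}) =
      ?R - int (rank M Y) - (\<Sum>G | cyclic_flat M G \<and> C \<subseteq> G. \<beta> G)" for C
  proof -
    have im: "h ` {j. j < n \<and> \<not> C \<subseteq> fst (h j)} = {p \<in> D. \<not> C \<subseteq> fst p}"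
      using bij_betw_imp_surj_on[OF h] by blast
    have "inj_on h {j. j < n \<and> \<not> C \<subseteq> fst (h j)}"
      using bij_betw_imp_inj_on[OF h] by (rule inj_on_subset) auto
    from card_image[OF this]
    have "card {j. j < n \<and> \<not> C \<subseteq> fst (h j)} = card {p \<in> D. \<not> C \<subseteq> fst p}"
      unfolding im by (rule sym)
    moreover have "card D = card {p \<in> D. C \<subseteq> fst p} + card {p \<in> D. \<not> C \<subseteq> fst p}"
    proof -
      have "D = {p \<in> D. C \<subseteq> fst p} \<union> {p \<in> D. \<not> C \<subseteq> fst p}" by blast
      also have "card \<dots> = card {p \<in> D. C \<subseteq> fst p} + card {p \<in> D. \<not> C \<subseteq> fst p}"
        using finD by (intro card_Un_disjoint) auto
      finally show ?thesis .
    qed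
    moreover have "int (card D) = ?R - int (rank M Y)"
      using count[of "\<lambda>_. True"] total by simp
    ultimately show ?thesis using count[of "\<lambda>G. C \<subseteq> G"] by simp
  qed
  have sys: "\<exists>\<phi>. inj_on \<phi> I \<and> (\<forall>x\<in>I. \<phi> x < n \<and> x \<in> S (\<phi> x))"
    if I: "I \<subseteq> W" and B: "basis (restriction M Y) B" and IB: "I \<union> B \<in> indep M" for I B
  proof -
    have B': "B \<in> indep M" "B \<subseteq> Y" "card B = rank M Y"
      using B by (auto simp: basis_restriction_iff)
    have "\<exists>\<phi>. inj_on \<phi> I \<and> (\<forall>x\<in>I. \<phi> x \<in> {j. j < n \<and> x \<in> S j})"
    proof (rule Hall_marriage)
      show "finite I" using IB finite_indep by blast
      show "finite {j. j < n \<and> x \<in> S j}" for x by simp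
      fix J assume J: "J \<subseteq> I"
      have Jg: "J \<subseteq> ground M" and disj: "J \<inter> B = {}" using J I W B' by auto
      \<comment> \<open>Adjoining \<open>J\<close> raises the rank of \<open>Y\<close> by at least
        \<open>card J\<close>, and \<open>upset\<close> shows that at least as many members meet
        \<open>J\<close>.\<close>
      have "card J + card B = card (J \<union> B)"
        using J IB finite_indep disj by (subst card_Un_disjoint) (auto intro: finite_subset)
      also have "\<dots> \<le> rank M (J \<union> Y)"
        using J B' by (intro card_le_rank indep_subset[OF IB]) auto
      finally have "int (card J) \<le> int (rank M (J \<union> Y)) - int (rank M Y)" using B' by simp
      moreover have "(\<Sum>G | cyclic_flat M G \<and> J \<subseteq> G. \<beta> G) \<le> ?R - int (rank M (J \<union> Y))"
        using Jg by (intro upset) auto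
      moreover have "(\<Union>x\<in>J. {j. j < n \<and> x \<in> S j}) = {j. j < n \<and> \<not> J \<subseteq> fst (h j)}"
        using J I by (auto simp: S_def)
      ultimately show "card J \<le> card (\<Union>x\<in>J. {j. j < n \<and> x \<in> S j})"
        using meeting[of J] by simp
    qed
    then show ?thesis by simp
  qed
  have ind: "I \<union> B \<in> indep M"
    if \<phi>: "inj_on \<phi> I" "\<forall>x\<in>I. \<phi> x < n \<and> x \<in> S (\<phi> x)" and B: "basis (restriction M Y) B"
    for I B \<phi>
  proof (rule ccontr)
    assume dep: "I \<union> B \<notin> indep M"
    have B': "B \<in> indep M" "B \<subseteq> Y" "card B = rank M Y"
      using B by (auto simp: basis_restriction_iff)
    have IW: "I \<subseteq> W" using \<phi> by (auto simp: S_def)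
    \<comment> \<open>From here \<open>D\<close> is a circuit, no longer the set of copies. Its
      closure is a cyclic flat containing \<open>C\<close>, the part of \<open>D\<close> in
      \<open>I\<close>. Together with \<open>Y\<close> this flat has rank so small that fewer than
      \<open>card C\<close> members meet \<open>C\<close>, although \<open>\<phi>\<close> maps
      \<open>C\<close> injectively into them.\<close>
    obtain D where D: "circuit M D" "D \<subseteq> I \<union> B"
      using dependent_has_circuit[OF _ dep] IW W B' Y by blast
    define C where "C = D \<inter> I"
    have gr: "C \<union> B \<subseteq> ground M" "D \<subseteq> ground M"
      using IW W B' Y D(1) by (auto simp: C_def circuit_def)
    have "D \<subseteq> C \<union> B" using D by (auto simp: C_def)
    then have "C \<union> B \<notin> indep M" using D(1) indep_subset by (auto simp: circuit_def)
    then have "rank M (C \<union> B) < card (C \<union> B)" using gr by (intro rank_less_card)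
    also have "\<dots> \<le> card C + rank M Y" using card_Un_le[of C B] B' by simp
    finally have lt: "rank M (C \<union> B) < card C + rank M Y" .
    let ?G = "closure M D"
    have "rank M (D \<union> Y) \<le> rank M (C \<union> B \<union> Y)"
      using \<open>D \<subseteq> C \<union> B\<close> by (intro rank_mono) auto
    \<comment> \<open>\<open>B\<close> spans \<open>Y\<close>, so adjoining \<open>Y\<close> leaves
      the rank unchanged.\<close>
    also have "\<dots> = rank M (C \<union> B)"
      using gr basis_spanning[OF Y B] by (intro rank_Un_closure_subset[of _ B]) auto
    finally have "rank M (D \<union> Y) < card C + rank M Y" using lt by simp
    moreover have "rank M (D \<union> Y \<union> ?G) = rank M (D \<union> Y)"
      using gr Y by (intro rank_Un_closure_subset[of _ D]) auto
    moreover have "D \<union> Y \<union> ?G = ?G \<union> Y" using subset_closure[OF gr(2)] by blast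
    ultimately have G: "rank M (?G \<union> Y) < card C + rank M Y" by simp
    have "C \<subseteq> ?G" using subset_closure[OF gr(2)] by (auto simp: C_def)
    then have "(\<Sum>G | cyclic_flat M G \<and> ?G \<subseteq> G. \<beta> G) \<le> (\<Sum>G | cyclic_flat M G \<and> C \<subseteq> G. \<beta> G)"
      using nonneg fin by (intro sum_mono2) auto
    then have "?R - int (rank M (?G \<union> Y)) \<le> (\<Sum>G | cyclic_flat M G \<and> C \<subseteq> G. \<beta> G)"
      using \<beta>[OF cyclic_flat_circuit_closure[OF D(1)]] by simp
    moreover have "card C \<le> card {j. j < n \<and> \<not> C \<subseteq> fst (h j)}"
    proof (rule card_inj_on_le)
      show "inj_on \<phi> C" using \<phi>(1) by (rule inj_on_subset) (simp add: C_def)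
      show "\<phi> ` C \<subseteq> {j. j < n \<and> \<not> C \<subseteq> fst (h j)}" using \<phi>(2) by (auto simp: C_def S_def)
    qed simp
    ultimately show False using meeting[of C] G by simp
  qed
  have "\<forall>I. I \<subseteq> W \<and> (\<exists>B. basis (restriction M Y) B \<and> I \<union> B \<in> indep M) \<longleftrightarrow>
      (\<exists>\<phi>. inj_on \<phi> I \<and> (\<forall>x\<in>I. \<phi> x < n \<and> x \<in> S (\<phi> x)))"
  proof (intro allI iffI)
    fix I assume "I \<subseteq> W \<and> (\<exists>B. basis (restriction M Y) B \<and> I \<union> B \<in> indep M)"
    then show "\<exists>\<phi>. inj_on \<phi> I \<and> (\<forall>x\<in>I. \<phi> x < n \<and> x \<in> S (\<phi> x))" using sys by blast
  next
    fix I assume "\<exists>\<phi>. inj_on \<phi> I \<and> (\<forall>x\<in>I. \<phi> x < n \<and> x \<in> S (\<phi> x))"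
    then obtain \<phi> where \<phi>: "inj_on \<phi> I" "\<forall>x\<in>I. \<phi> x < n \<and> x \<in> S (\<phi> x)" by blast
    obtain B where B: "basis (restriction M Y) B"
      using extend_to_basis[OF indep_empty, of Y] by blast
    show "I \<subseteq> W \<and> (\<exists>B. basis (restriction M Y) B \<and> I \<union> B \<in> indep M)"
      using ind[OF \<phi> B] B \<phi>(2) by (auto simp: S_def)
  qed
  moreover have "\<forall>j<n. S j \<subseteq> W" by (simp add: S_def)
  ultimately show ?thesis by (intro exI[of _ n] exI[of _ S] conjI)
qed

section \<open>From MI-lattices to minors\<close>

lemma MI_orderable_inequality:
  assumes "antichain (cyclic_flat_lattice M) A" "A \<noteq> {}"
    and "MI_orderable (cyclic_flat_lattice M) A" "Y \<subseteq> ground M"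
  shows "int (rank M (\<Inter>A \<union> Y)) \<le>
    (\<Sum>F | F \<subseteq> A \<and> F \<noteq> {}. (-1) ^ (card F + 1) * int (rank M (\<Union>F \<union> Y)))"
proof -
  obtain t a where "MI_ordering (cyclic_flat_lattice M) A t a"
    using assms(3) by (auto simp: MI_orderable_def)
  moreover have "cyclic_flat M X" if "X \<in> A" for X
    using assms(1) that by (auto simp: antichain_def cyclic_flat_lattice_def)
  ultimately show ?thesis using assms(2,4) by (rule MI_ordering_inequality)
qed

text \<open>Since \<open>X\<close> and \<open>Y\<close> are disjoint, the bases of \<open>Y\<close>
  are the same before and after deleting \<open>X\<close>, so independence in the minor can be read
  off in \<open>M\<close>.\<close>

lemma MI_lattice_minor_transversal:
  assumes MI: "MI_lattice (cyclic_flat_lattice M)" and N: "minor N M"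
  shows "transversal N"
proof -
  obtain X Y where XY: "X \<subseteq> ground M" "Y \<subseteq> ground M" "X \<inter> Y = {}"
    and N: "N = contraction (deletion M X) Y"
    using N unfolding minor_def by blast
  let ?W = "ground M - X - Y"
  have "restriction (deletion M X) Y = restriction M Y"
    using XY by (auto simp: restriction_def deletion_def)
  moreover have "J \<in> indep (deletion M X) \<longleftrightarrow> J \<in> indep M \<and> J \<subseteq> ground M - X" for J
    by (auto simp: deletion_def restriction_def)
  moreover have "ground (deletion M X) = ground M - X"
    by (auto simp: deletion_def restriction_def)
  moreover have "B \<subseteq> ground M - X" if "basis (restriction M Y) B" for B
    using that XY by (auto simp: basis_restriction_iff)
  ultimately have indep_N:
    "I \<in> indep N \<longleftrightarrow> I \<subseteq> ?W \<and> (\<exists>B. basis (restriction M Y) B \<and> I \<union> B \<in> indep M)" for I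
    unfolding N contraction_def by (auto simp: le_sup_iff) blast+
  have "ground N = ?W" by (auto simp: N contraction_def deletion_def restriction_def)
  then show ?thesis
    unfolding transversal_def indep_N
    using Mason_Ingleton[OF XY(2) MI_orderable_inequality[OF _ _ _ XY(2)], of ?W] MI
    by (auto simp: MI_lattice_def)
qed

text \<open>The empty set is deleted and contracted. Transversality of \<open>M\<close> thereby
  becomes an instance of the claim about minors.\<close>

lemma minor_refl: "minor M M"
proof -
  have "basis (restriction M {}) B \<longleftrightarrow> B = {}" for B
    using indep_empty by (auto simp: basis_def restriction_def)
  moreover have "deletion M {} = M"
    using indep_subset_ground by (intro matroid.equality) (auto simp: deletion_def restriction_def)
  ultimately have "contraction (deletion M {}) {} = M"
    using indep_subset_ground by (intro matroid.equality) (auto simp: contraction_def)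
  then show ?thesis unfolding minor_def by (metis empty_subsetI inf_bot_left)
qed

end

theorem theorem3p4:
  fixes M :: "'a matroid"
  assumes "matroid M"
  shows "(\<forall>\<A>. antichain (cyclic_flat_lattice M) \<A> \<and> \<A> \<noteq> {} \<and>
              MI_orderable (cyclic_flat_lattice M) \<A> \<longrightarrow>
            int (rank M (\<Inter>X\<in>\<A>. X)) \<le>
              (\<Sum>\<F>\<in>{\<F>. \<F> \<noteq> {} \<and> \<F> \<subseteq> \<A>}.
                 (-1) ^ (card \<F> + 1) * int (rank M (\<Union>X\<in>\<F>. X)))) \<and>
         (MI_lattice (cyclic_flat_lattice M) \<longrightarrow>
            transversal M \<and> (\<forall>N. minor N M \<longrightarrow> transversal N))"
proof -
  interpret matroid M by (rule assms)
  have "int (rank M (\<Inter>X\<in>A. X)) \<le>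
      (\<Sum>F\<in>{F. F \<noteq> {} \<and> F \<subseteq> A}. (-1) ^ (card F + 1) * int (rank M (\<Union>X\<in>F. X)))"
    if "antichain (cyclic_flat_lattice M) A" "A \<noteq> {}" "MI_orderable (cyclic_flat_lattice M) A"
    for A
    using MI_orderable_inequality[OF that, of "{}"] by (simp add: conj_commute)
  moreover have "transversal N" if "MI_lattice (cyclic_flat_lattice M)" "minor N M" for N
    using that by (rule MI_lattice_minor_transversal)
  ultimately show ?thesis using minor_refl by simp
qed

end
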